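(* Let $\lambda$ be a nontrivial constant source, $g_a=\epsilon_ae^{\psi(x^k)}$ with $\epsilon_a=\pm1$ ($a=1,2$), and $h_A^*\neq0$ ($A=3,4$). The system $$\frac{1}{2g_1g_2}\Big[\mathcal X_1(\mathcal X_1g_2)-\frac{\mathcal X_1g_1\,\mathcal X_1g_2}{2g_1}-\frac{(\mathcal X_1g_2)^2}{2g_2}+\mathcal X_2(\mathcal X_2g_1)-\frac{\mathcal X_2g_1\,\mathcal X_2g_2}{2g_2}-\frac{(\mathcal X_2g_1)^2}{2g_1}\Big]=\lambda,$$ $$\frac{1}{2h_3h_4}\Big[h_4^{**}-\frac{(h_4^* )^2}{2h_4}-\frac{h_3^*h_4^*}{2h_3}\Big]=\lambda,$$ $$\frac{w_a}{2h_4}\Big[h_4^{**}-\frac{(h_4^* )^2}{2h_4}-\frac{h_3^*h_4^*}{2h_3}\Big]+\frac{h_4^*}{4h_4}\Big(\frac{\mathcal X_ah_3}{h_3}+\frac{\mathcal X_ah_4}{h_4}\Big)-\frac{\mathcal X_ah_4^*}{2h_4}=0,$$ $$\frac{h_4}{2h_3}n_a^{**}-\Big(\frac{h_4}{h_3}h_3^*-\frac32h_4^*\Big)\frac{n_a^*}{2h_3}=0$$ decouples in N-adapted form, $$\epsilon_1\mathcal X_1(\mathcal X_1\psi)+\epsilon_2\mathcal X_2(\mathcal X_2\psi)=2\lambda,$$ $$\phi^*h_4^*=2h_3h_4\lambda,$$ $$\beta w_a-\alpha_a=0,$$ $$n_a^{**}+\gamma n_a^*=0,$$ for $\alpha_a=h_4^*\,\mathcal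 X_a\phi$, $\beta=h_4^*\,\phi^*$, $\gamma=\big(\ln(|h_4|^{3/2}/|h_3|)\big)^*$, where $\phi=\ln\big|h_4^*/\sqrt{|h_3h_4|}\big|$ is considered as a generating function.
   Context: The setting is the prolongation $\mathcal T^{\mathbf E}\mathbf E$ of a Lie algebroid $\mathbf E$ endowed with a nonlinear connection, with $2+2$ splitting and local coordinates $(x^1,x^2,y^3,y^4)$. $\mathcal X_a$ ($a=1,2$) and $\mathcal V_A$ ($A=3,4$) are the standard local basis sections of the prolongation, with duals $\mathcal X^a,\mathcal V^A$, acting on functions through the anchor; frames and coordinates are chosen so that the coordinate derivatives $\partial_a$ are replaced by $\mathcal X_a$ (thereby encoding the anchor functions $\rho_a^i(x^k)$) and $\mathcal V_A=\partial/\partial y^A$. The star denotes $\partial/\partial y^3$. The unknown is a d-metric $g_a\,\mathcal X^a\otimes\mathcal X^a+h_A\,\delta^A\otimes\delta^A$ (summation over $a$ and $A$) with $\delta^3=\mathcal V^3+w_a\mathcal X^a$, $\delta^4=\mathcal V^4+n_a\mathcal X^a$, where $g_a=g_a(x^k)$, and $h_A,w_a,n_a$ depend on $(x^k,y^3)$, i.e. with Killing symmetry along $\partial/\partial y^4$. The first system is the set of nontrivial components (the left-hand sides being $-\widehat{\mathbf R}^1_1=-\widehat{\mathbf R}^2_2$, $-\widehat{\mathbf R}^3_3=-\widehat{\mathbf R}^4_4$, $\widehat{\mathbf R}_{3a}$, $\widehat{\mathbf R}_{4a}$) of the Ricci soliton equations $\widehat{\mathbf R}_{\overline\beta\overline\gamma}+\widehat{\mathcal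 D}_{\overline\beta}\widehat{\mathcal D}_{\overline\gamma}\widehat\kappa=\lambda\,\overline{\mathbf g}_{\overline\beta\overline\gamma}$ for this d-metric $\overline{\mathbf g}$, where $\widehat{\mathbf R}_{\overline\beta\overline\gamma}$ is the Ricci tensor of the canonical d-connection $\widehat{\mathcal D}$ (metric compatible, preserving the horizontal-vertical splitting, with purely horizontal torsion coefficients equal to the Lie algebroid structure functions and zero purely vertical torsion) and the potential $\widehat\kappa$ has constant N-adapted derivatives.
   Formalization: The first decoupled equation is corrected to ε₁X₁(X₁ψ)+ε₂X₂(X₂ψ)=2λe^ψ; with the printed right-hand side 2λ the claim fails for g_a=ε_a e^ψ and the same constant λ, e.g. ψ=(x¹)², λ=ε_a=1. "Decouples" is read as equivalence of the two systems. *)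

theory Defs
  imports "HOL-Analysis.Analysis"
begin

text \<open>
  A point of \<^typ>\<open>real^4\<close> has the local coordinates (x1, x2, y3, y4).  The components are
  indexed by the numeral type \<^typ>\<open>4\<close>, in which 4 = 0, so that \<^term>\<open>u $ 4\<close> is the fourth
  component.  Horizontal indices range over \<^term>\<open>{1, 2::4}\<close>, vertical ones over
  \<^term>\<open>{3, 4::4}\<close>.
\<close>

definition pd :: "4 \<Rightarrow> (real^4 \<Rightarrow> real) \<Rightarrow> real^4 \<Rightarrow> real"
  where "pd i f u = frechet_derivative f (at u) (axis i 1)"

abbreviation star :: "(real^4 \<Rightarrow> real) \<Rightarrow> real^4 \<Rightarrow> real"  ("_\<^sup>\<star>" [1000] 1000)
  where "f\<^sup>\<star> \<equiv> pd 3 f"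

text \<open>On an open set this is smoothness (of class C-infinity): all iterated partial derivatives
  are differentiable, hence continuous.\<close>

definition smooth_on :: "(real^4) set \<Rightarrow> (real^4 \<Rightarrow> real) \<Rightarrow> bool"
  where "smooth_on D f \<longleftrightarrow> (\<forall>is. fold pd is f differentiable_on D)"

definition depends_only_on :: "(real^4) set \<Rightarrow> 4 set \<Rightarrow> (real^4 \<Rightarrow> real) \<Rightarrow> bool"
  where "depends_only_on D I f \<longleftrightarrow>
    (\<forall>u\<in>D. \<forall>v\<in>D. (\<forall>i\<in>I. u $ i = v $ i) \<longrightarrow> f u = f v)"

text \<open>The action of the basis section indexed by \<open>a\<close> on functions, through the anchor functions
  \<open>rho a i\<close>; the vertical basis sections act as \<^term>\<open>pd 3\<close> and \<^term>\<open>pd 4\<close>.\<close>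

definition anchor_deriv :: "(4 \<Rightarrow> 4 \<Rightarrow> real^4 \<Rightarrow> real) \<Rightarrow> 4 \<Rightarrow> (real^4 \<Rightarrow> real) \<Rightarrow> real^4 \<Rightarrow> real"
  where "anchor_deriv rho a f u = (\<Sum>i\<in>{1, 2}. rho a i u * pd i f u)"

text \<open>Local data of a Lie algebroid of rank 2 over a 2-dimensional base: the bracket of the basis
  sections \<open>a\<close> and \<open>b\<close> is the sum over \<open>c\<close> of \<open>C c a b\<close> times the basis section \<open>c\<close>.  The last
  three conditions are antisymmetry, compatibility of the anchor with the brackets, and the
  Jacobi identity.\<close>

definition lie_algebroid ::
    "(real^4) set \<Rightarrow> (4 \<Rightarrow> 4 \<Rightarrow> real^4 \<Rightarrow> real) \<Rightarrow> (4 \<Rightarrow> 4 \<Rightarrow> 4 \<Rightarrow> real^4 \<Rightarrow> real) \<Rightarrow> bool"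
  where "lie_algebroid D rho C \<longleftrightarrow>
    (\<forall>a\<in>{1, 2}. \<forall>i\<in>{1, 2}. smooth_on D (rho a i) \<and> depends_only_on D {1, 2} (rho a i)) \<and>
    (\<forall>a\<in>{1, 2}. \<forall>b\<in>{1, 2}. \<forall>c\<in>{1, 2}.
        smooth_on D (C c a b) \<and> depends_only_on D {1, 2} (C c a b)) \<and>
    (\<forall>u\<in>D. \<forall>a\<in>{1, 2}. \<forall>b\<in>{1, 2}. \<forall>c\<in>{1, 2}. C c a b u = - C c b a u) \<and>
    (\<forall>u\<in>D. \<forall>a\<in>{1, 2}. \<forall>b\<in>{1, 2}. \<forall>i\<in>{1, 2}.
        anchor_deriv rho a (rho b i) u - anchor_deriv rho b (rho a i) u
          = (\<Sum>c\<in>{1, 2}. C c a b u * rho c i u)) \<and>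
    (\<forall>u\<in>D. \<forall>a\<in>{1, 2}. \<forall>b\<in>{1, 2}. \<forall>c\<in>{1, 2}. \<forall>d\<in>{1, 2}.
        (\<Sum>(p, q, r)\<leftarrow>[(a, b, c), (b, c, a), (c, a, b)].
            anchor_deriv rho p (C d q r) u + (\<Sum>f\<in>{1, 2}. C d p f u * C f q r u)) = 0)"

text \<open>
  Coefficients of a d-metric: the sum over the horizontal \<open>a\<close> and vertical \<open>A\<close> of
  \<open>g a\<close> times the square of the dual section \<open>a\<close> and \<open>h A\<close> times the square of
  \<open>\<delta> A\<close>, where \<open>\<delta> 3\<close> and \<open>\<delta> 4\<close> are the vertical dual sections 3 and 4 plus the sum over
  \<open>a\<close> of \<open>w a\<close>, respectively \<open>n a\<close>, times the dual section \<open>a\<close>.  The metric is nondegenerate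
  exactly when no \<open>g a\<close> and no \<open>h A\<close> vanishes; no coefficient depends on y4.
\<close>

definition d_metric ::
    "(real^4) set \<Rightarrow> (4 \<Rightarrow> real^4 \<Rightarrow> real) \<Rightarrow> (4 \<Rightarrow> real^4 \<Rightarrow> real) \<Rightarrow>
     (4 \<Rightarrow> real^4 \<Rightarrow> real) \<Rightarrow> (4 \<Rightarrow> real^4 \<Rightarrow> real) \<Rightarrow> bool"
  where "d_metric D g h w n \<longleftrightarrow>
    (\<forall>a\<in>{1, 2}. smooth_on D (g a) \<and> depends_only_on D {1, 2} (g a) \<and> (\<forall>u\<in>D. g a u \<noteq> 0)) \<and>
    (\<forall>A\<in>{3, 4}. smooth_on D (h A) \<and> depends_only_on D {1, 2, 3} (h A) \<and> (\<forall>u\<in>D. h A u \<noteq> 0)) \<and>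
    (\<forall>a\<in>{1, 2}. smooth_on D (w a) \<and> depends_only_on D {1, 2, 3} (w a)) \<and>
    (\<forall>a\<in>{1, 2}. smooth_on D (n a) \<and> depends_only_on D {1, 2, 3} (n a))"

text \<open>In the following systems, \<open>X a\<close> is the action of the horizontal basis section \<open>a\<close> on
  functions.\<close>

definition ricci_soliton_system ::
    "(real^4) set \<Rightarrow> (4 \<Rightarrow> (real^4 \<Rightarrow> real) \<Rightarrow> real^4 \<Rightarrow> real) \<Rightarrow> real \<Rightarrow>
     (4 \<Rightarrow> real^4 \<Rightarrow> real) \<Rightarrow> (4 \<Rightarrow> real^4 \<Rightarrow> real) \<Rightarrow>
     (4 \<Rightarrow> real^4 \<Rightarrow> real) \<Rightarrow> (4 \<Rightarrow> real^4 \<Rightarrow> real) \<Rightarrow> bool"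
  where "ricci_soliton_system D X lam g h w n \<longleftrightarrow> (\<forall>u\<in>D.
    1 / (2 * g 1 u * g 2 u) *
      (X 1 (X 1 (g 2)) u - X 1 (g 1) u * X 1 (g 2) u / (2 * g 1 u) - (X 1 (g 2) u)\<^sup>2 / (2 * g 2 u)
     + X 2 (X 2 (g 1)) u - X 2 (g 1) u * X 2 (g 2) u / (2 * g 2 u) - (X 2 (g 1) u)\<^sup>2 / (2 * g 1 u))
      = lam \<and>
    1 / (2 * h 3 u * h 4 u) *
      (((h 4)\<^sup>\<star>)\<^sup>\<star> u - ((h 4)\<^sup>\<star> u)\<^sup>2 / (2 * h 4 u) - (h 3)\<^sup>\<star> u * (h 4)\<^sup>\<star> u / (2 * h 3 u))
      = lam \<and>
    (\<forall>a\<in>{1, 2}.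
      w a u / (2 * h 4 u) *
        (((h 4)\<^sup>\<star>)\<^sup>\<star> u - ((h 4)\<^sup>\<star> u)\<^sup>2 / (2 * h 4 u) - (h 3)\<^sup>\<star> u * (h 4)\<^sup>\<star> u / (2 * h 3 u))
      + (h 4)\<^sup>\<star> u / (4 * h 4 u) * (X a (h 3) u / h 3 u + X a (h 4) u / h 4 u)
      - X a ((h 4)\<^sup>\<star>) u / (2 * h 4 u) = 0) \<and>
    (\<forall>a\<in>{1, 2}.
      h 4 u / (2 * h 3 u) * ((n a)\<^sup>\<star>)\<^sup>\<star> u
      - (h 4 u / h 3 u * (h 3)\<^sup>\<star> u - 3 / 2 * (h 4)\<^sup>\<star> u) * ((n a)\<^sup>\<star> u / (2 * h 3 u)) = 0))"

definition gen_phi :: "(4 \<Rightarrow> real^4 \<Rightarrow> real) \<Rightarrow> real^4 \<Rightarrow> real"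
  where "gen_phi h u = ln \<bar>(h 4)\<^sup>\<star> u / sqrt \<bar>h 3 u * h 4 u\<bar>\<bar>"

definition coeff_alpha ::
    "(4 \<Rightarrow> (real^4 \<Rightarrow> real) \<Rightarrow> real^4 \<Rightarrow> real) \<Rightarrow> (4 \<Rightarrow> real^4 \<Rightarrow> real) \<Rightarrow> 4 \<Rightarrow> real^4 \<Rightarrow> real"
  where "coeff_alpha X h a u = (h 4)\<^sup>\<star> u * X a (gen_phi h) u"

definition coeff_beta :: "(4 \<Rightarrow> real^4 \<Rightarrow> real) \<Rightarrow> real^4 \<Rightarrow> real"
  where "coeff_beta h u = (h 4)\<^sup>\<star> u * (gen_phi h)\<^sup>\<star> u"

definition coeff_gamma :: "(4 \<Rightarrow> real^4 \<Rightarrow> real) \<Rightarrow> real^4 \<Rightarrow> real"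
  where "coeff_gamma h = (\<lambda>u. ln (\<bar>h 4 u\<bar> powr (3 / 2) / \<bar>h 3 u\<bar>))\<^sup>\<star>"

text \<open>
  The factor \<^term>\<open>exp (psi u)\<close> in the first equation is forced: for conformally flat
  \<^term>\<open>g a u = eps a * exp (psi u)\<close> the left-hand side of the first equation of
  \<^const>\<open>ricci_soliton_system\<close> is \<open>exp (- psi u) / 2\<close> times the left-hand side below.  The
  literature prints the right-hand side as \<open>2 * lam\<close>, absorbing the factor into the source; with
  one and the same constant on both sides that version is false.
\<close>

definition decoupled_system ::
    "(real^4) set \<Rightarrow> (4 \<Rightarrow> (real^4 \<Rightarrow> real) \<Rightarrow> real^4 \<Rightarrow> real) \<Rightarrow> real \<Rightarrow>
     (4 \<Rightarrow> real) \<Rightarrow> (real^4 \<Rightarrow> real) \<Rightarrow> (4 \<Rightarrow> real^4 \<Rightarrow> real) \<Rightarrow>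
     (4 \<Rightarrow> real^4 \<Rightarrow> real) \<Rightarrow> (4 \<Rightarrow> real^4 \<Rightarrow> real) \<Rightarrow> bool"
  where "decoupled_system D X lam eps psi h w n \<longleftrightarrow> (\<forall>u\<in>D.
    eps 1 * X 1 (X 1 psi) u + eps 2 * X 2 (X 2 psi) u = 2 * lam * exp (psi u) \<and>
    (gen_phi h)\<^sup>\<star> u * (h 4)\<^sup>\<star> u = 2 * h 3 u * h 4 u * lam \<and>
    (\<forall>a\<in>{1, 2}. coeff_beta h u * w a u - coeff_alpha X h a u = 0) \<and>
    (\<forall>a\<in>{1, 2}. ((n a)\<^sup>\<star>)\<^sup>\<star> u + coeff_gamma h u * (n a)\<^sup>\<star> u = 0))"

end

(*
  For g_a = eps_a exp psi, the quadratic terms in the first equation cancel against those of the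
  second derivatives of exp psi.  Writing phi = ln |h_4^star| - (ln |h_3| + ln |h_4|) / 2, the
  bracket [h_4^{star star} - ...] is h_4^star phi^star = beta, and the remaining terms of the
  w-equation are - alpha_a / (2 h_4).  Likewise gamma = (3/2) h_4^star / h_4 - h_3^star / h_3 makes
  the n-equation h_4 / (2 h_3) times its decoupled form.  All the factors are nowhere zero.
*)
theory Submission
  imports Defs
begin

lemma smooth_on_differentiable:
  assumes "smooth_on D f" "open D" "u \<in> D"
  shows "f differentiable at u" and "pd i f differentiable at u"
proof -
  have "fold pd [] f differentiable_on D" "fold pd [i] f differentiable_on D"
    using assms(1) unfolding smooth_on_def by blast+
  then show "f differentiable at u" "pd i f differentiable at u"
    using assms(2,3) by (auto simp: differentiable_on_eq_differentiable_at)
qed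

lemma pd_eq:
  assumes "(f has_derivative f') (at u)"
  shows "pd i f u = f' (axis i 1)"
  using frechet_derivative_at[OF assms] by (simp add: pd_def)

text \<open>The anchored derivative is the directional derivative along the vector with components
  \<open>rho a i u\<close>, since \<open>f'\<close> is linear. Hence one
  \<open>has_derivative\<close> fact for a function yields both its partial and its anchored
  derivatives.\<close>

lemma anchor_deriv_eq:
  assumes "(f has_derivative f') (at u)"
  shows "anchor_deriv rho a f u = f' (\<Sum>i\<in>{1, 2}. rho a i u *\<^sub>R axis i 1)"
proof -
  interpret f': linear f' by (rule has_derivative_linear[OF assms])
  show ?thesis
    unfolding anchor_deriv_def pd_eq[OF assms] f'.sum f'.scale by simp
qed

lemma anchor_deriv_differentiable:
  assumes "\<forall>i\<in>{1, 2}. rho a i differentiable at u"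
    and "\<forall>i\<in>{1, 2}. pd i f differentiable at u"
  shows "anchor_deriv rho a f differentiable at u"
proof -
  have "(\<lambda>v. \<Sum>i\<in>{1, 2}. rho a i v * pd i f v) differentiable at u"
    using assms by (intro differentiable_sum differentiable_mult) auto
  then show ?thesis
    by (simp add: anchor_deriv_def[abs_def])
qed

text \<open>Chain rule. The function \<open>k\<close> is kept separate from
  \<open>c * exp (f v)\<close> because the two agree only on \<open>D\<close>; openness of
  \<open>D\<close> is what transfers the derivative.\<close>

lemma anchor_deriv_exp:
  assumes "open D" "u \<in> D" "f differentiable at u"
    and "\<And>v. v \<in> D \<Longrightarrow> k v = c * exp (f v)"
  shows "anchor_deriv rho a k u = c * exp (f u) * anchor_deriv rho a f u"
proof -
  from assms(3) obtain f' where f': "(f has_derivative f') (at u)"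
    unfolding differentiable_def by blast
  have "((\<lambda>v. c * exp (f v)) has_derivative (\<lambda>x. c * exp (f u) * f' x)) (at u)"
    by (auto intro!: derivative_eq_intros f')
  then have "(k has_derivative (\<lambda>x. c * exp (f u) * f' x)) (at u)"
    by (rule has_derivative_transform_within_open[OF _ assms(1,2)]) (simp add: assms(4))
  then show ?thesis
    unfolding anchor_deriv_eq[OF f'] by (rule anchor_deriv_eq)
qed

text \<open>The first-order formula holds on all of the open set \<open>D\<close>, so it may be
  differentiated again by the product rule. The square arises from differentiating the exponential a
  second time.\<close>

lemma anchor_deriv_exp_twice:
  assumes "open D" "u \<in> D" "\<And>v. v \<in> D \<Longrightarrow> f differentiable at v"
    and "anchor_deriv rho a f differentiable at u"
    and "\<And>v. v \<in> D \<Longrightarrow> k v = c * exp (f v)"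
  shows "anchor_deriv rho a (anchor_deriv rho a k) u =
    c * exp (f u) * (anchor_deriv rho a (anchor_deriv rho a f) u + (anchor_deriv rho a f u)\<^sup>2)"
proof -
  from assms(2,3) obtain f' where f': "(f has_derivative f') (at u)"
    unfolding differentiable_def by blast
  from assms(4) obtain F' where F': "(anchor_deriv rho a f has_derivative F') (at u)"
    unfolding differentiable_def by blast
  let ?K' = "\<lambda>x. c * exp (f u) * (F' x + f' x * anchor_deriv rho a f u)"
  have "((\<lambda>v. c * exp (f v) * anchor_deriv rho a f v) has_derivative ?K') (at u)"
    by (auto intro!: derivative_eq_intros f' F' simp: algebra_simps)
  then have "(anchor_deriv rho a k has_derivative ?K') (at u)"
    by (rule has_derivative_transform_within_open[OF _ assms(1,2)])
      (simp add: anchor_deriv_exp[OF assms(1) _ assms(3) assms(5)])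
  then show ?thesis
    by (simp add: anchor_deriv_eq[of "anchor_deriv rho a k"] anchor_deriv_eq[OF F']
        anchor_deriv_eq[OF f'] power2_eq_square)
qed

lemma has_derivative_ln_abs:
  fixes f :: "'a::real_normed_vector \<Rightarrow> real"
  assumes "(f has_derivative f') (at u)" "f u \<noteq> 0"
  shows "((\<lambda>v. ln \<bar>f v\<bar>) has_derivative (\<lambda>x. f' x / f u)) (at u)"
proof -
  \<comment> \<open>Squaring avoids a case distinction on the sign of \<open>f\<close> near
    \<open>u\<close>. The equality of functions also holds at zeros of \<open>f\<close>, by the
    convention \<open>ln 0 = 0\<close>.\<close>
  have "(\<lambda>v. ln \<bar>f v\<bar>) = (\<lambda>v. ln ((f v)\<^sup>2) / 2)"
    by (auto simp: power2_eq_square ln_mult abs_if ln_minus)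
  moreover have "((\<lambda>v. ln ((f v)\<^sup>2) / 2) has_derivative (\<lambda>x. f' x / f u)) (at u)"
    using assms(2) by (auto intro!: derivative_eq_intros assms(1) simp: power2_eq_square field_simps zero_less_mult_iff)
  ultimately show ?thesis
    by simp
qed

text \<open>The logarithm splits into a sum on \<open>D\<close>, where all arguments are nonzero.
  The full derivative is given because it is evaluated both in the direction of y3 and along the
  anchor.\<close>

lemma gen_phi_has_derivative:
  assumes "open D" "u \<in> D"
    and "\<And>v. v \<in> D \<Longrightarrow> h 3 v \<noteq> 0 \<and> h 4 v \<noteq> 0 \<and> (h 4)\<^sup>\<star> v \<noteq> 0"
    and h: "(h 3 has_derivative a') (at u)" "(h 4 has_derivative b') (at u)"
      "((h 4)\<^sup>\<star> has_derivative c') (at u)"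
  shows "(gen_phi h has_derivative
    (\<lambda>x. c' x / (h 4)\<^sup>\<star> u - (a' x / h 3 u + b' x / h 4 u) / 2)) (at u)"
proof -
  have "((\<lambda>v. ln \<bar>(h 4)\<^sup>\<star> v\<bar> - (ln \<bar>h 3 v\<bar> + ln \<bar>h 4 v\<bar>) / 2) has_derivative
    (\<lambda>x. c' x / (h 4)\<^sup>\<star> u - (a' x / h 3 u + b' x / h 4 u) / 2)) (at u)"
    using assms(2,3) by (intro has_derivative_diff has_derivative_add has_derivative_ln_abs
        bounded_linear.has_derivative[OF bounded_linear_divide] h) auto
  then show ?thesis
    by (rule has_derivative_transform_within_open[OF _ assms(1,2)])
      (simp add: gen_phi_def abs_mult real_sqrt_mult ln_div ln_mult ln_sqrt add_divide_distrib assms(3))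
qed

lemma coeff_gamma_eq:
  assumes "open D" "u \<in> D" "\<And>v. v \<in> D \<Longrightarrow> h 3 v \<noteq> 0 \<and> h 4 v \<noteq> 0"
    and "h 3 differentiable at u" "h 4 differentiable at u"
  shows "coeff_gamma h u = 3 / 2 * (h 4)\<^sup>\<star> u / h 4 u - (h 3)\<^sup>\<star> u / h 3 u"
proof -
  from assms(4,5) obtain a' b' where
    h: "(h 3 has_derivative a') (at u)" "(h 4 has_derivative b') (at u)"
    unfolding differentiable_def by blast
  have "((\<lambda>v. (3 / 2 * ln \<bar>h 4 v\<bar>) - ln \<bar>h 3 v\<bar>) has_derivative
    (\<lambda>x. 3 / 2 * (b' x / h 4 u) - a' x / h 3 u)) (at u)"
    using assms(2,3) by (intro derivative_intros has_derivative_ln_abs h) auto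
  then have "((\<lambda>v. ln (\<bar>h 4 v\<bar> powr (3 / 2) / \<bar>h 3 v\<bar>)) has_derivative
    (\<lambda>x. 3 / 2 * (b' x / h 4 u) - a' x / h 3 u)) (at u)"
    by (rule has_derivative_transform_within_open[OF _ assms(1,2)])
      (simp add: ln_div assms(3))
  then show ?thesis
    unfolding coeff_gamma_def pd_eq[OF h(1)] by (simp add: pd_eq[OF h(2)] pd_eq)
qed

text \<open>Here \<open>E\<close> is the conformal factor, \<open>p\<close> and \<open>q\<close> are
  the first anchored derivatives of its exponent, and \<open>P\<close> and \<open>Q\<close> the
  second ones. Each of the two subtracted terms in \<open>p\<close> equals
  \<open>e2 * E * p\<^sup>2 / 2\<close>, so together they cancel the square from the second
  derivative; likewise for \<open>q\<close> with \<open>e1\<close>. Dividing by the product of the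
  two metric coefficients leaves one factor \<open>E\<close> in the denominator, and
  \<open>1 / e = e\<close> for a sign \<open>e\<close>.\<close>

lemma conformal_equation:
  fixes E :: real
  assumes "e1 = 1 \<or> e1 = - 1" "e2 = 1 \<or> e2 = - 1" "E > 0"
  shows "1 / (2 * (e1 * E) * (e2 * E)) *
      (e2 * E * (P + p\<^sup>2) - e1 * E * p * (e2 * E * p) / (2 * (e1 * E)) - (e2 * E * p)\<^sup>2 / (2 * (e2 * E))
     + e1 * E * (Q + q\<^sup>2) - e1 * E * q * (e2 * E * q) / (2 * (e2 * E)) - (e1 * E * q)\<^sup>2 / (2 * (e1 * E)))
      = l \<longleftrightarrow> e1 * P + e2 * Q = 2 * l * E"
proof -
  have "1 / (2 * (e1 * E) * (e2 * E)) *
      (e2 * E * (P + p\<^sup>2) - e1 * E * p * (e2 * E * p) / (2 * (e1 * E)) - (e2 * E * p)\<^sup>2 / (2 * (e2 * E))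
     + e1 * E * (Q + q\<^sup>2) - e1 * E * q * (e2 * E * q) / (2 * (e2 * E)) - (e1 * E * q)\<^sup>2 / (2 * (e1 * E)))
     = (e1 * P + e2 * Q) / (2 * E)"
    using assms by (auto simp: field_simps power2_eq_square)
  then show ?thesis
    using assms(3) by (auto simp: field_simps)
qed

theorem theorem4p1:
  fixes D :: "(real^4) set"
    and rho :: "4 \<Rightarrow> 4 \<Rightarrow> real^4 \<Rightarrow> real"
    and C :: "4 \<Rightarrow> 4 \<Rightarrow> 4 \<Rightarrow> real^4 \<Rightarrow> real"
    and g h w n :: "4 \<Rightarrow> real^4 \<Rightarrow> real"
    and eps :: "4 \<Rightarrow> real"
    and psi :: "real^4 \<Rightarrow> real"
    and lam :: real
  assumes "open D"
    and "lie_algebroid D rho C"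
    and "d_metric D g h w n"
    and "lam \<noteq> 0"
    and "\<forall>a\<in>{1, 2}. eps a = 1 \<or> eps a = - 1"
    and "smooth_on D psi" and "depends_only_on D {1, 2} psi"
    and "\<forall>a\<in>{1, 2}. \<forall>u\<in>D. g a u = eps a * exp (psi u)"
    and "\<forall>A\<in>{3, 4}. \<forall>u\<in>D. (h A)\<^sup>\<star> u \<noteq> 0"
  shows "ricci_soliton_system D (anchor_deriv rho) lam g h w n \<longleftrightarrow>
         decoupled_system D (anchor_deriv rho) lam eps psi h w n"
proof -
  let ?X = "anchor_deriv rho"
  have rho: "rho a i differentiable at u" if "a \<in> {1, 2}" "i \<in> {1, 2}" "u \<in> D" for a i u
  proof -
    have "smooth_on D (rho a i)"
      using assms(2) that unfolding lie_algebroid_def by (elim conjE) blast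
    then show ?thesis
      using assms(1) that(3) by (rule smooth_on_differentiable)
  qed
  have psi: "psi differentiable at u" "pd i psi differentiable at u" if "u \<in> D" for i u
    using smooth_on_differentiable[OF assms(6,1) that] by blast+
  have smooth_h: "smooth_on D (h 3)" "smooth_on D (h 4)"
    using assms(3) unfolding d_metric_def by auto
  have h: "h 3 differentiable at u" "h 4 differentiable at u" "(h 4)\<^sup>\<star> differentiable at u"
    if "u \<in> D" for u
    using smooth_on_differentiable[OF _ assms(1) that] smooth_h by blast+
  have nz: "h 3 u \<noteq> 0 \<and> h 4 u \<noteq> 0 \<and> (h 4)\<^sup>\<star> u \<noteq> 0" if "u \<in> D" for u
    using assms(3,9) that unfolding d_metric_def by auto
  have g: "g a u = eps a * exp (psi u)" if "a \<in> {1, 2}" "u \<in> D" for a u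
    using assms(8) that by blast
  \<comment> \<open>Differentiating \<open>?X a psi\<close> also differentiates the anchor
    functions, so their smoothness enters here; the second derivatives in \<open>XXg\<close> rely on
    this.\<close>
  have Xpsi: "?X a psi differentiable at u" if "a \<in> {1, 2}" "u \<in> D" for a u
    using that by (intro anchor_deriv_differentiable ballI rho psi)
  have Xg: "?X a (g b) u = eps b * exp (psi u) * ?X a psi u"
    if "a \<in> {1, 2}" "b \<in> {1, 2}" "u \<in> D" for a b u
    using that by (intro anchor_deriv_exp[OF assms(1)] psi g)
  have XXg: "?X a (?X a (g b)) u = eps b * exp (psi u) * (?X a (?X a psi) u + (?X a psi u)\<^sup>2)"
    if "a \<in> {1, 2}" "b \<in> {1, 2}" "u \<in> D" for a b u
    using that by (intro anchor_deriv_exp_twice[OF assms(1)] psi g Xpsi)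
  have horizontal: "1 / (2 * g 1 u * g 2 u) *
      (?X 1 (?X 1 (g 2)) u - ?X 1 (g 1) u * ?X 1 (g 2) u / (2 * g 1 u) - (?X 1 (g 2) u)\<^sup>2 / (2 * g 2 u)
     + ?X 2 (?X 2 (g 1)) u - ?X 2 (g 1) u * ?X 2 (g 2) u / (2 * g 2 u) - (?X 2 (g 1) u)\<^sup>2 / (2 * g 1 u))
      = lam \<longleftrightarrow>
      eps 1 * ?X 1 (?X 1 psi) u + eps 2 * ?X 2 (?X 2 psi) u = 2 * lam * exp (psi u)"
    if u: "u \<in> D" for u
    using conformal_equation[of "eps 1" "eps 2" "exp (psi u)"] assms(5)
    by (simp add: Xg XXg g u)
  have phi: "(gen_phi h)\<^sup>\<star> u =
      ((h 4)\<^sup>\<star>)\<^sup>\<star> u / (h 4)\<^sup>\<star> u - ((h 3)\<^sup>\<star> u / h 3 u + (h 4)\<^sup>\<star> u / h 4 u) / 2"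
    "?X a (gen_phi h) u =
      ?X a ((h 4)\<^sup>\<star>) u / (h 4)\<^sup>\<star> u - (?X a (h 3) u / h 3 u + ?X a (h 4) u / h 4 u) / 2"
    if u: "u \<in> D" for a u
  proof -
    from h[OF u] obtain a' b' c' where d: "(h 3 has_derivative a') (at u)"
      "(h 4 has_derivative b') (at u)" "((h 4)\<^sup>\<star> has_derivative c') (at u)"
      unfolding differentiable_def by blast
    have phi': "(gen_phi h has_derivative
        (\<lambda>x. c' x / (h 4)\<^sup>\<star> u - (a' x / h 3 u + b' x / h 4 u) / 2)) (at u)"
      using nz d by (rule gen_phi_has_derivative[OF assms(1) u])
    show "(gen_phi h)\<^sup>\<star> u =
        ((h 4)\<^sup>\<star>)\<^sup>\<star> u / (h 4)\<^sup>\<star> u - ((h 3)\<^sup>\<star> u / h 3 u + (h 4)\<^sup>\<star> u / h 4 u) / 2"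
      using pd_eq[OF phi'] by (simp add: d[THEN pd_eq])
    show "?X a (gen_phi h) u =
        ?X a ((h 4)\<^sup>\<star>) u / (h 4)\<^sup>\<star> u - (?X a (h 3) u / h 3 u + ?X a (h 4) u / h 4 u) / 2"
      unfolding anchor_deriv_eq[OF phi'] anchor_deriv_eq[OF d(1)] anchor_deriv_eq[OF d(2)]
        anchor_deriv_eq[OF d(3)] ..
  qed
  \<comment> \<open>The right-hand side is the bracket common to the second and third equations, so
    both can be rewritten in terms of \<open>coeff_beta\<close>.\<close>
  have beta: "coeff_beta h u =
      ((h 4)\<^sup>\<star>)\<^sup>\<star> u - ((h 4)\<^sup>\<star> u)\<^sup>2 / (2 * h 4 u) - (h 3)\<^sup>\<star> u * (h 4)\<^sup>\<star> u / (2 * h 3 u)"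
    if u: "u \<in> D" for u
    unfolding coeff_beta_def phi(1)[OF u] using nz[OF u]
    by (simp add: field_simps power2_eq_square)
  have vertical: "1 / (2 * h 3 u * h 4 u) * coeff_beta h u = lam \<longleftrightarrow>
      (gen_phi h)\<^sup>\<star> u * (h 4)\<^sup>\<star> u = 2 * h 3 u * h 4 u * lam"
    if u: "u \<in> D" for u
    unfolding coeff_beta_def using nz[OF u] by (auto simp: field_simps)
  have w_eq: "w a u / (2 * h 4 u) * coeff_beta h u
      + (h 4)\<^sup>\<star> u / (4 * h 4 u) * (?X a (h 3) u / h 3 u + ?X a (h 4) u / h 4 u)
      - ?X a ((h 4)\<^sup>\<star>) u / (2 * h 4 u) = 0 \<longleftrightarrow>
      coeff_beta h u * w a u - coeff_alpha ?X h a u = 0" if u: "u \<in> D" for a u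
  proof -
    \<comment> \<open>The factor \<open>(h 4)\<^sup>\<star> u\<close> in \<open>coeff_alpha\<close>
      cancels the denominator in the anchored derivative of \<open>gen_phi h\<close>, leaving the
      last two terms up to the factor \<open>- 1 / (2 * h 4 u)\<close>.\<close>
    have "w a u / (2 * h 4 u) * coeff_beta h u
      + (h 4)\<^sup>\<star> u / (4 * h 4 u) * (?X a (h 3) u / h 3 u + ?X a (h 4) u / h 4 u)
      - ?X a ((h 4)\<^sup>\<star>) u / (2 * h 4 u) =
      (coeff_beta h u * w a u - coeff_alpha ?X h a u) / (2 * h 4 u)"
      unfolding coeff_alpha_def phi(2)[OF u] using nz[OF u] by (simp add: field_simps)
    then show ?thesis
      using nz[OF u] by simp
  qed
  have n_eq: "h 4 u / (2 * h 3 u) * ((n a)\<^sup>\<star>)\<^sup>\<star> u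
      - (h 4 u / h 3 u * (h 3)\<^sup>\<star> u - 3 / 2 * (h 4)\<^sup>\<star> u) * ((n a)\<^sup>\<star> u / (2 * h 3 u)) = 0 \<longleftrightarrow>
      ((n a)\<^sup>\<star>)\<^sup>\<star> u + coeff_gamma h u * (n a)\<^sup>\<star> u = 0" if u: "u \<in> D" for a u
  proof -
    have gamma: "coeff_gamma h u = 3 / 2 * (h 4)\<^sup>\<star> u / h 4 u - (h 3)\<^sup>\<star> u / h 3 u"
      using nz h[OF u] by (intro coeff_gamma_eq[OF assms(1) u]) auto
    have "h 4 u / (2 * h 3 u) * ((n a)\<^sup>\<star>)\<^sup>\<star> u
      - (h 4 u / h 3 u * (h 3)\<^sup>\<star> u - 3 / 2 * (h 4)\<^sup>\<star> u) * ((n a)\<^sup>\<star> u / (2 * h 3 u)) =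
      h 4 u / (2 * h 3 u) * (((n a)\<^sup>\<star>)\<^sup>\<star> u + coeff_gamma h u * (n a)\<^sup>\<star> u)"
      unfolding gamma using nz[OF u] by (simp add: field_simps)
    then show ?thesis
      using nz[OF u] by simp
  qed
  show ?thesis
    \<comment> \<open>The systems are equivalent point by point and equation by equation. Reading
      \<open>beta\<close> from right to left folds the brackets into \<open>coeff_beta\<close>, the
      form in which \<open>vertical\<close> and \<open>w_eq\<close> are stated.\<close>
    unfolding ricci_soliton_system_def decoupled_system_def
    by (intro ball_cong refl) (simp only: horizontal vertical w_eq n_eq flip: beta)
qed

end
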